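(* Let $\Phi=(\phi_n)_{n\in I}$ and $\Psi=(\psi_n)_{n\in I}$ be frames for a separable Hilbert space $\mathcal{H}$, and let $m=(m_n)_{n\in I}$ be a sequence of complex numbers such that $m_n\neq 0$ for every $n$ and the sequence $m\Phi=(m_n\phi_n)_{n\in I}$ is a frame for $\mathcal{H}$. Consider the following statements: (1) $M_{m,\Phi,\Psi}$ is invertible and $\Psi^\dagger=\widetilde{\Psi}$, where $\Psi^\dagger:=\left(M_{m,\Phi,\Psi}^{-1}(m_n\phi_n)\right)_{n\in I}$; (2) $\Psi$ is equivalent to $m\Phi$; (3) $M_{m,\Phi,\Psi}$ is invertible and $M_{m,\Phi,\Psi}^{-1}=M_{1/m,\widetilde{\Psi},\widetilde{\Phi}}$. Then (1) $\Leftrightarrow$ (2) and (2) $\Rightarrow$ (3).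
   Context: $I$ is a countable index set. A sequence $(\phi_n)_{n\in I}$ in $\mathcal{H}$ is a frame for $\mathcal{H}$ if there are $A,B\in(0,\infty)$ with $A\|f\|^2\le\sum_{n\in I}|\langle f,\phi_n\rangle|^2\le B\|f\|^2$ for all $f\in\mathcal{H}$. Its frame operator is $S_\Phi f=\sum_{n\in I}\langle f,\phi_n\rangle\phi_n$ (bounded and bijective on $\mathcal{H}$), and its canonical dual frame is $\widetilde{\Phi}=(S_\Phi^{-1}\phi_n)_{n\in I}$; likewise $\widetilde{\Psi}=(S_\Psi^{-1}\psi_n)_{n\in I}$. Two frames $(\phi_n)_{n\in I}$ and $(\psi_n)_{n\in I}$ for $\mathcal{H}$ are called equivalent if there is a bounded bijective operator $G:\mathcal{H}\to\mathcal{H}$ with $\psi_n=G\phi_n$ for all $n$. For a complex sequence $m=(m_n)_{n\in I}$ and sequences $\Phi,\Psi$ in $\mathcal{H}$, the multiplier $M_{m,\Phi,\Psi}$ is the operator $M_{m,\Phi,\Psi}f=\sum_{n\in I} m_n\langle f,\psi_n\rangle\phi_n$, defined on those $f\in\mathcal{H}$ for which the series converges. $1/m$ denotes the sequence $(1/m_n)_{n\in I}$. An operator on $\mathcal{H}$ is called invertible if it is a bounded bijective operator from $\mathcal{H}$ onto $\mathcal{H}$. *)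

theory Defs
  imports "HOL-Analysis.Analysis"
begin

text \<open>
  Complex inner product spaces, with the inner product linear in its first argument.  The axiom
  \<open>cinner_self\<close> makes the inner product positive and ties it to the norm; definiteness is then
  the axiom \<open>norm_eq_zero\<close> of real normed spaces.
\<close>

class complex_inner = real_normed_vector +
  fixes scaleC :: "complex \<Rightarrow> 'a \<Rightarrow> 'a"  (infixr \<open>*\<^sub>C\<close> 75)
    and cinner :: "'a \<Rightarrow> 'a \<Rightarrow> complex"
  assumes scaleC_add_right: "a *\<^sub>C (x + y) = a *\<^sub>C x + a *\<^sub>C y"
    and scaleC_add_left: "(a + b) *\<^sub>C x = a *\<^sub>C x + b *\<^sub>C x"
    and scaleC_scaleC: "a *\<^sub>C b *\<^sub>C x = (a * b) *\<^sub>C x"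
    and scaleR_scaleC: "r *\<^sub>R x = complex_of_real r *\<^sub>C x"
    and cinner_commute: "cinner x y = cnj (cinner y x)"
    and cinner_add_left: "cinner (x + y) z = cinner x z + cinner y z"
    and cinner_scaleC_left: "cinner (a *\<^sub>C x) y = a * cinner x y"
    and cinner_self: "cinner x x = complex_of_real ((norm x)\<^sup>2)"

class chilbert_space = complex_inner + complete_space

instantiation complex :: chilbert_space
begin

definition scaleC_complex :: "complex \<Rightarrow> complex \<Rightarrow> complex" where
  "scaleC_complex a x = a * x"

definition cinner_complex :: "complex \<Rightarrow> complex \<Rightarrow> complex" where
  "cinner_complex x y = x * cnj y"

instance
proof
  fix a b x y z :: complex and r :: real
  show "a *\<^sub>C (x + y) = a *\<^sub>C x + a *\<^sub>C y"
    by (simp add: scaleC_complex_def distrib_left)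
  show "(a + b) *\<^sub>C x = a *\<^sub>C x + b *\<^sub>C x"
    by (simp add: scaleC_complex_def distrib_right)
  show "a *\<^sub>C b *\<^sub>C x = (a * b) *\<^sub>C x"
    by (simp add: scaleC_complex_def mult.assoc)
  show "r *\<^sub>R x = complex_of_real r *\<^sub>C x"
    by (simp add: scaleC_complex_def scaleR_conv_of_real)
  show "cinner x y = cnj (cinner y x)"
    by (simp add: cinner_complex_def mult.commute)
  show "cinner (x + y) z = cinner x z + cinner y z"
    by (simp add: cinner_complex_def distrib_right)
  show "cinner (a *\<^sub>C x) y = a * cinner x y"
    by (simp add: cinner_complex_def scaleC_complex_def mult.assoc)
  show "cinner x x = complex_of_real ((norm x)\<^sup>2)"
    unfolding cinner_complex_def by (rule complex_norm_square [symmetric])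
qed

end

definition bounded_clinear :: "('h::complex_inner \<Rightarrow> 'h) \<Rightarrow> bool" where
  "bounded_clinear G \<longleftrightarrow> bounded_linear G \<and> (\<forall>c x. G (c *\<^sub>C x) = c *\<^sub>C G x)"

text \<open>
  Sequences indexed by \<open>I\<close> are functions of which only the values on \<open>I\<close> matter.  As \<open>I\<close>
  carries no order, series over \<open>I\<close> are the unordered (i.e. unconditionally convergent) sums of
  \<^theory>\<open>HOL-Analysis.Infinite_Sum\<close>.
\<close>

definition frame :: "'i set \<Rightarrow> ('i \<Rightarrow> 'h::complex_inner) \<Rightarrow> bool" where
  "frame I \<phi> \<longleftrightarrow>
     (\<exists>A>0. \<exists>B>0. \<forall>f.
        (\<lambda>n. (cmod (cinner f (\<phi> n)))\<^sup>2) summable_on I \<and>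
        A * (norm f)\<^sup>2 \<le> (\<Sum>\<^sub>\<infinity>n\<in>I. (cmod (cinner f (\<phi> n)))\<^sup>2) \<and>
        (\<Sum>\<^sub>\<infinity>n\<in>I. (cmod (cinner f (\<phi> n)))\<^sup>2) \<le> B * (norm f)\<^sup>2)"

definition frame_operator :: "'i set \<Rightarrow> ('i \<Rightarrow> 'h::complex_inner) \<Rightarrow> 'h \<Rightarrow> 'h" where
  "frame_operator I \<phi> f = (\<Sum>\<^sub>\<infinity>n\<in>I. cinner f (\<phi> n) *\<^sub>C \<phi> n)"

definition canonical_dual :: "'i set \<Rightarrow> ('i \<Rightarrow> 'h::complex_inner) \<Rightarrow> 'i \<Rightarrow> 'h" where
  "canonical_dual I \<phi> n = inv (frame_operator I \<phi>) (\<phi> n)"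

definition equivalent_frames ::
    "'i set \<Rightarrow> ('i \<Rightarrow> 'h::complex_inner) \<Rightarrow> ('i \<Rightarrow> 'h) \<Rightarrow> bool" where
  "equivalent_frames I \<phi> \<psi> \<longleftrightarrow>
     (\<exists>G. bounded_clinear G \<and> bij G \<and> (\<forall>n\<in>I. \<psi> n = G (\<phi> n)))"

text \<open>
  Operators that need not be defined everywhere are partial maps, so that an equation between two
  of them includes the equality of their domains.
\<close>

definition multiplier ::
    "'i set \<Rightarrow> ('i \<Rightarrow> complex) \<Rightarrow> ('i \<Rightarrow> 'h::complex_inner) \<Rightarrow> ('i \<Rightarrow> 'h) \<Rightarrow> ('h \<rightharpoonup> 'h)" where
  "multiplier I m \<phi> \<psi> f =
     (if (\<lambda>n. (m n * cinner f (\<psi> n)) *\<^sub>C \<phi> n) summable_on I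
      then Some (\<Sum>\<^sub>\<infinity>n\<in>I. (m n * cinner f (\<psi> n)) *\<^sub>C \<phi> n) else None)"

definition invertible_operator :: "('h::complex_inner \<rightharpoonup> 'h) \<Rightarrow> bool" where
  "invertible_operator T \<longleftrightarrow> (\<exists>G. bounded_clinear G \<and> bij G \<and> T = (\<lambda>f. Some (G f)))"

text \<open>Meaningful for injective \<open>T\<close>; the domain of the inverse is the range of \<open>T\<close>.\<close>

definition inverse_operator :: "('h \<rightharpoonup> 'h) \<Rightarrow> ('h \<rightharpoonup> 'h)" where
  "inverse_operator T g = (if g \<in> ran T then Some (THE f. T f = Some g) else None)"

text \<open>The sequence \<open>\<psi>\<^sup>\<dagger>\<close>; only meaningful when the multiplier is invertible.\<close>

definition multiplier_dual ::
    "'i set \<Rightarrow> ('i \<Rightarrow> complex) \<Rightarrow> ('i \<Rightarrow> 'h::complex_inner) \<Rightarrow> ('i \<Rightarrow> 'h) \<Rightarrow> 'i \<Rightarrow> 'h" where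
  "multiplier_dual I m \<phi> \<psi> n = the (inverse_operator (multiplier I m \<phi> \<psi>) (m n *\<^sub>C \<phi> n))"

end

theory Submission
  imports Defs
begin

text \<open>
  Put \<open>\<eta> = m \<phi>\<close>. The multiplier is \<open>M f = (\<Sum>n. \<langle>f, \<psi>\<^sub>n\<rangle> \<eta>\<^sub>n)\<close>, so if \<open>\<eta> = G \<psi>\<close> then \<open>M = G S\<close> with \<open>S\<close>
  the frame operator of \<open>\<psi>\<close>, whence \<open>M\<close> is invertible and maps the canonical dual of \<open>\<psi>\<close> to \<open>\<eta>\<close>.
  Conversely, if \<open>M\<close> does this then \<open>\<eta> = (M S\<^sup>-\<^sup>1) \<psi>\<close>. The formula for the inverse results from applying
  the bounded operator \<open>S\<^sup>-\<^sup>1 G\<^sup>-\<^sup>1\<close> to the reconstruction formula \<open>f = (\<Sum>n. \<langle>f, \<phi>'\<^sub>n\<rangle> \<phi>\<^sub>n)\<close> termwise, where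
  \<open>\<phi>'\<close> is the canonical dual of \<open>\<phi>\<close>.
\<close>

subclass (in chilbert_space) banach ..

subsection \<open>Complex inner product spaces\<close>

lemma cinner_scaleC_right: "cinner x (a *\<^sub>C y) = cnj a * cinner x y"
  for x y :: "'h::complex_inner"
  by (metis cinner_commute cinner_scaleC_left complex_cnj_mult)

lemma additive_cinner_left: "Modules.additive (\<lambda>x::'h::complex_inner. cinner x y)"
  by (simp add: Modules.additive_def cinner_add_left)

lemma cinner_diff_left: "cinner (x - y) z = cinner x z - cinner y z"
  for x y z :: "'h::complex_inner"
  using Modules.additive.diff[OF additive_cinner_left] .

lemma cinner_sum_left: "cinner (sum f F) y = (\<Sum>n\<in>F. cinner (f n) y)"
  for y :: "'h::complex_inner"
  using Modules.additive.sum[OF additive_cinner_left] .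

lemma norm_cinner_commute: "cmod (cinner x y) = cmod (cinner y x)"
  for x y :: "'h::complex_inner"
  by (metis cinner_commute complex_mod_cnj)

text \<open>Both sides agree after squaring: \<open>cinner_self\<close> turns the square into an
  inner product, from which \<open>a\<close> and \<open>cnj a\<close> are pulled out.\<close>

lemma norm_scaleC: "norm (a *\<^sub>C x) = cmod a * norm x"
  for x :: "'h::complex_inner"
proof -
  have "complex_of_real ((norm (a *\<^sub>C x))\<^sup>2) = a * (cnj a * complex_of_real ((norm x)\<^sup>2))"
    by (metis cinner_self cinner_scaleC_left cinner_scaleC_right)
  also have "\<dots> = complex_of_real ((cmod a * norm x)\<^sup>2)"
    by (metis complex_norm_square mult.assoc of_real_mult power_mult_distrib)
  finally show ?thesis
    by (simp only: of_real_eq_iff) (simp add: power2_eq_iff_nonneg)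
qed

lemma norm_diff_square:
  "(norm (x - y))\<^sup>2 = (norm x)\<^sup>2 - 2 * Re (cinner y x) + (norm y)\<^sup>2"
  for x y :: "'h::complex_inner"
proof -
  have "cinner (x - y) (x - y) = cinner x x - cinner y x - cnj (cinner y x) + cinner y y"
    by (simp add: cinner_diff_left cinner_commute[of x "x - y"] cinner_commute[of y "x - y"])
       (simp add: cinner_commute[of x y] cinner_self flip: of_real_power)
  then have "Re (cinner (x - y) (x - y)) =
      Re (cinner x x) - 2 * Re (cinner y x) + Re (cinner y y)"
    by simp
  then show ?thesis
    by (simp add: cinner_self)
qed

lemma norm_cinner_le: "cmod (cinner x y) \<le> norm x * norm y"
  for x y :: "'h::complex_inner"
proof (cases "y = 0")
  case True
  then show ?thesis
    using norm_cinner_commute[of x 0] Modules.additive.zero[OF additive_cinner_left] by simp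
next
  case False
  \<comment> \<open>\<open>t *\<^sub>C y\<close> is the orthogonal projection of \<open>x\<close>
    onto the line through \<open>y\<close>. The inequality says that the squared norm of the
    remainder \<open>x - t *\<^sub>C y\<close> is nonnegative.\<close>
  define t where "t = cinner x y / of_real ((norm y)\<^sup>2)"
  have "Re (cinner (t *\<^sub>C y) x) = (cmod (cinner x y))\<^sup>2 / (norm y)\<^sup>2"
  proof -
    have "cinner (t *\<^sub>C y) x = cinner x y * cnj (cinner x y) / of_real ((norm y)\<^sup>2)"
      unfolding t_def cinner_scaleC_left cinner_commute[of y x] by simp
    also have "\<dots> = of_real ((cmod (cinner x y))\<^sup>2 / (norm y)\<^sup>2)"
      by (simp only: complex_norm_square[symmetric] of_real_divide)
    finally show ?thesis
      by (metis Re_complex_of_real)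
  qed
  moreover have "(norm (t *\<^sub>C y))\<^sup>2 = (cmod (cinner x y))\<^sup>2 / (norm y)\<^sup>2"
  proof -
    have "cmod t = cmod (cinner x y) / (norm y)\<^sup>2"
      by (simp add: t_def norm_divide norm_power)
    then show ?thesis
      using False by (simp add: norm_scaleC power2_eq_square)
  qed
  ultimately have "(norm (x - t *\<^sub>C y))\<^sup>2 = (norm x)\<^sup>2 - (cmod (cinner x y))\<^sup>2 / (norm y)\<^sup>2"
    by (simp add: norm_diff_square)
  then have "(cmod (cinner x y))\<^sup>2 / (norm y)\<^sup>2 \<le> (norm x)\<^sup>2"
    by (metis diff_ge_0_iff_ge zero_le_power2)
  then have "(cmod (cinner x y))\<^sup>2 \<le> (norm x * norm y)\<^sup>2"
    using False by (simp add: divide_le_eq power_mult_distrib)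
  then show ?thesis
    by (rule power2_le_imp_le) simp
qed

section \<open>Bounded complex-linear operators\<close>

lemma bounded_linear_cinner_left: "bounded_linear (\<lambda>x::'h::complex_inner. cinner x y)"
  by (rule bounded_linear_intro[where K = "norm y"])
     (simp_all add: cinner_add_left scaleR_scaleC cinner_scaleC_left norm_cinner_le
       flip: scaleR_conv_of_real)

lemma bounded_linear_scaleC: "bounded_linear (\<lambda>x::'h::complex_inner. a *\<^sub>C x)"
  by (rule bounded_linear_intro[where K = "cmod a"])
     (simp_all add: scaleC_add_right scaleR_scaleC scaleC_scaleC norm_scaleC mult.commute)

lemma bounded_clinear_comp:
  assumes "bounded_clinear F" "bounded_clinear G"
  shows "bounded_clinear (F \<circ> G)"
  using assms bounded_linear_compose[of F G] by (simp add: bounded_clinear_def comp_def)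

text \<open>Linearity passes to the inverse by injectivity, and the lower bound \<open>A\<close> for
  \<open>G\<close> becomes the upper bound \<open>1 / A\<close> for the inverse.\<close>

lemma bounded_clinear_inv:
  assumes G: "bounded_clinear G" "bij G"
    and "A > 0" "\<And>x. A * norm x \<le> norm (G x)"
  shows "bounded_clinear (inv G)"
proof -
  interpret G: bounded_linear G
    using G(1) by (simp add: bounded_clinear_def)
  have G_inv: "G (inv G y) = y" for y
    using G(2) by (simp add: bij_is_surj surj_f_inv_f)
  have inv_eq: "inv G y = x" if "G x = y" for x y
    using G(2) that by (auto simp: bij_is_inj)
  have "bounded_linear (inv G)"
  proof (rule bounded_linear_intro[where K = "1 / A"])
    show "inv G (x + y) = inv G x + inv G y" for x y
      by (rule inv_eq) (simp add: G.add G_inv)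
    show "inv G (r *\<^sub>R x) = r *\<^sub>R inv G x" for r x
      by (rule inv_eq) (simp add: G.scaleR G_inv)
    show "norm (inv G x) \<le> norm x * (1 / A)" for x
      using assms(4)[of "inv G x"] \<open>A > 0\<close> by (simp add: G_inv field_simps)
  qed
  moreover have "inv G (c *\<^sub>C x) = c *\<^sub>C inv G x" for c x
    using G(1) by (intro inv_eq) (simp add: bounded_clinear_def G_inv)
  ultimately show ?thesis
    by (simp add: bounded_clinear_def)
qed

subsection \<open>Bessel sequences and mixed frame operators\<close>

text \<open>Two finite sets containing \<open>F0\<close> have sums within \<open>e / 2\<close> of
  the sum over \<open>F0\<close>, so the partial sums form a Cauchy filter, which converges by
  completeness.\<close>

lemma summable_on_CauchyI:
  fixes f :: "'i \<Rightarrow> 'a::banach"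
  assumes "\<And>e. e > 0 \<Longrightarrow> \<exists>F0. finite F0 \<and> F0 \<subseteq> I \<and>
             (\<forall>F. finite F \<and> F \<subseteq> I - F0 \<longrightarrow> norm (sum f F) < e)"
  shows "f summable_on I"
proof -
  have "\<exists>P. eventually P (finite_subsets_at_top I) \<and>
            (\<forall>F F'. P F \<and> P F' \<longrightarrow> dist (sum f F) (sum f F') < e)" if e: "e > 0" for e
  proof -
    obtain F0 where F0: "finite F0 \<and> F0 \<subseteq> I \<and>
        (\<forall>F. finite F \<and> F \<subseteq> I - F0 \<longrightarrow> norm (sum f F) < e / 2)"
      using assms[OF half_gt_zero[OF e]] ..
    define P where "P F \<longleftrightarrow> finite F \<and> F0 \<subseteq> F \<and> F \<subseteq> I" for F
    have near: "dist (sum f F) (sum f F0) < e / 2" if "P F" for F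
    proof -
      have "sum f F - sum f F0 = sum f (F - F0)"
        using that by (simp add: P_def sum_diff)
      then show ?thesis
        using that F0 by (simp add: dist_norm P_def Diff_mono)
    qed
    have "eventually P (finite_subsets_at_top I)"
      unfolding eventually_finite_subsets_at_top P_def using F0 by blast
    moreover have "dist (sum f F) (sum f F') < e" if "P F" "P F'" for F F'
      using near[OF that(1)] near[OF that(2)] by (rule dist_triangle_half_l)
    ultimately show ?thesis
      by blast
  qed
  then have "cauchy_filter (filtermap (sum f) (finite_subsets_at_top I))"
    by (simp add: cauchy_filter_metric_filtermap)
  moreover have "complete (UNIV::'a set)"
    by (meson Cauchy_convergent UNIV_I complete_def convergent_def)
  ultimately obtain L where "(sum f \<longlongrightarrow> L) (finite_subsets_at_top I)"
    using complete_uniform[where S=UNIV] by (force simp add: filterlim_def)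
  then show ?thesis
    using summable_on_def has_sum_def by blast
qed

text \<open>The sums over \<open>F0\<close> and over \<open>F0 \<union> F\<close> both lie within
  \<open>e / 2\<close> of the total, and they differ by the sum over \<open>F\<close>.\<close>

lemma summable_on_tail:
  fixes f :: "'i \<Rightarrow> real"
  assumes "f summable_on I" "e > 0"
  obtains F0 where "finite F0" "F0 \<subseteq> I"
    "\<And>F. finite F \<Longrightarrow> F \<subseteq> I - F0 \<Longrightarrow> sum f F < e"
proof -
  have "(sum f \<longlongrightarrow> infsum f I) (finite_subsets_at_top I)"
    using assms(1) by (simp add: has_sum_infsum flip: has_sum_def)
  then have "eventually (\<lambda>F. dist (sum f F) (infsum f I) < e / 2) (finite_subsets_at_top I)"
    using assms(2) by (intro tendstoD) simp_all
  then obtain F0 where F0: "finite F0 \<and> F0 \<subseteq> I \<and>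
      (\<forall>F. finite F \<and> F0 \<subseteq> F \<and> F \<subseteq> I \<longrightarrow> dist (sum f F) (infsum f I) < e / 2)"
    unfolding eventually_finite_subsets_at_top ..
  show thesis
  proof (rule that)
    show "finite F0" "F0 \<subseteq> I"
      using F0 by simp_all
    fix F assume F: "finite F" "F \<subseteq> I - F0"
    then have "sum f (F0 \<union> F) = sum f F0 + sum f F"
      using F0 by (intro sum.union_disjoint) auto
    moreover have "dist (sum f (F0 \<union> F)) (infsum f I) < e / 2"
      using F F0 by (simp add: subset_iff)
    moreover have "dist (sum f F0) (infsum f I) < e / 2"
      using F0 by simp
    ultimately show "sum f F < e"
      unfolding dist_real_def by linarith
  qed
qed

text \<open>The upper frame inequality, with its bound kept as a parameter. Stated for finite
  partial sums, it needs no prior summability; \<open>B > 0\<close> allows division by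
  \<open>B\<close>.\<close>

definition bessel :: "'i set \<Rightarrow> ('i \<Rightarrow> 'h::complex_inner) \<Rightarrow> real \<Rightarrow> bool" where
  "bessel I \<phi> B \<longleftrightarrow> B > 0 \<and>
     (\<forall>f F. finite F \<and> F \<subseteq> I \<longrightarrow> (\<Sum>n\<in>F. (cmod (cinner f (\<phi> n)))\<^sup>2) \<le> B * (norm f)\<^sup>2)"

lemma bessel_summable:
  assumes "bessel I \<phi> B"
  shows "(\<lambda>n. (cmod (cinner f (\<phi> n)))\<^sup>2) summable_on I"
  using assms
  by (intro nonneg_bdd_above_summable_on bdd_aboveI[where M = "B * (norm f)\<^sup>2"])
     (auto simp: bessel_def)

lemma frame_bessel:
  assumes "frame I \<phi>"
  obtains B where "bessel I \<phi> B"
proof -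
  obtain B where B: "B > 0"
    and "\<And>f. (\<lambda>n. (cmod (cinner f (\<phi> n)))\<^sup>2) summable_on I"
    and "\<And>f. (\<Sum>\<^sub>\<infinity>n\<in>I. (cmod (cinner f (\<phi> n)))\<^sup>2) \<le> B * (norm f)\<^sup>2"
    using assms unfolding frame_def by blast
  then have "(\<Sum>n\<in>F. (cmod (cinner f (\<phi> n)))\<^sup>2) \<le> B * (norm f)\<^sup>2" if "finite F" "F \<subseteq> I" for f F
    using that by (intro order_trans[OF finite_sum_le_infsum]) auto
  with B show thesis
    by (intro that) (auto simp: bessel_def)
qed

text \<open>Duality: with \<open>s\<close> the synthesized vector, the square of its norm is the sum
  of \<open>c n * cinner (\<phi> n) s\<close>. Cauchy-Schwarz and the Bessel inequality at
  \<open>s\<close> itself bound this, and one factor \<open>(norm s)\<^sup>2\<close>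
  cancels.\<close>

lemma bessel_synthesis_le:
  assumes "bessel I \<phi> B" "finite F" "F \<subseteq> I"
  shows "(norm (\<Sum>n\<in>F. c n *\<^sub>C \<phi> n))\<^sup>2 \<le> B * (\<Sum>n\<in>F. (cmod (c n))\<^sup>2)"
proof -
  define s where "s = (\<Sum>n\<in>F. c n *\<^sub>C \<phi> n)"
  have "(norm s)\<^sup>2 = cmod (cinner s s)"
    by (simp add: cinner_self norm_power)
  also have "\<dots> = cmod (\<Sum>n\<in>F. c n * cinner (\<phi> n) s)"
    by (subst (1) s_def) (simp add: cinner_sum_left cinner_scaleC_left)
  also have "\<dots> \<le> (\<Sum>n\<in>F. cmod (c n) * cmod (cinner s (\<phi> n)))"
    by (rule order_trans[OF norm_sum]) (simp add: norm_mult norm_cinner_commute[of s])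
  \<comment> \<open>Squared once more to match the squared form of Cauchy-Schwarz for finite
    sums.\<close>
  finally have "((norm s)\<^sup>2)\<^sup>2 \<le> (\<Sum>n\<in>F. cmod (c n) * cmod (cinner s (\<phi> n)))\<^sup>2"
    by (rule power_mono) simp
  also have "\<dots> \<le> (\<Sum>n\<in>F. (cmod (c n))\<^sup>2) * (\<Sum>n\<in>F. (cmod (cinner s (\<phi> n)))\<^sup>2)"
    by (rule Cauchy_Schwarz_ineq_sum)
  also have "\<dots> \<le> (\<Sum>n\<in>F. (cmod (c n))\<^sup>2) * (B * (norm s)\<^sup>2)"
    using assms by (intro mult_left_mono sum_nonneg) (auto simp: bessel_def)
  finally have *: "(norm s)\<^sup>2 * (norm s)\<^sup>2 \<le> B * (\<Sum>n\<in>F. (cmod (c n))\<^sup>2) * (norm s)\<^sup>2"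
    by (simp add: power2_eq_square mult_ac)
  show ?thesis
  proof (cases "s = 0")
    case True
    with assms show ?thesis
      by (simp add: s_def bessel_def sum_nonneg)
  next
    case False
    with * show ?thesis
      unfolding s_def by (simp only: mult_le_cancel_right) simp
  qed
qed

lemma bessel_synthesis_summable:
  fixes \<phi> :: "'i \<Rightarrow> 'h::chilbert_space"
  assumes \<phi>: "bessel I \<phi> B" and c: "(\<lambda>n. (cmod (c n))\<^sup>2) summable_on I"
  shows "(\<lambda>n. c n *\<^sub>C \<phi> n) summable_on I"
proof (rule summable_on_CauchyI)
  fix e :: real assume "e > 0"
  have "B > 0"
    using \<phi> by (simp add: bessel_def)
  \<comment> \<open>A coefficient tail below \<open>e\<^sup>2 / B\<close> gives a synthesized vector
    of norm below \<open>e\<close>.\<close>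
  have "e\<^sup>2 / B > 0"
    using \<open>e > 0\<close> \<open>B > 0\<close> by simp
  then obtain F0 where F0: "finite F0" "F0 \<subseteq> I"
    "\<And>F. finite F \<Longrightarrow> F \<subseteq> I - F0 \<Longrightarrow> (\<Sum>n\<in>F. (cmod (c n))\<^sup>2) < e\<^sup>2 / B"
    using summable_on_tail[OF c] by metis
  have "norm (\<Sum>n\<in>F. c n *\<^sub>C \<phi> n) < e" if F: "finite F" "F \<subseteq> I - F0" for F
  proof (rule power2_less_imp_less)
    have "(norm (\<Sum>n\<in>F. c n *\<^sub>C \<phi> n))\<^sup>2 \<le> B * (\<Sum>n\<in>F. (cmod (c n))\<^sup>2)"
      using F by (intro bessel_synthesis_le[OF \<phi>]) auto
    also have "\<dots> < e\<^sup>2"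
      using F0(3)[OF F] \<open>B > 0\<close> by (simp add: field_simps)
    finally show "(norm (\<Sum>n\<in>F. c n *\<^sub>C \<phi> n))\<^sup>2 < e\<^sup>2" .
  qed (use \<open>e > 0\<close> in simp)
  with F0(1,2) show "\<exists>F0. finite F0 \<and> F0 \<subseteq> I \<and>
      (\<forall>F. finite F \<and> F \<subseteq> I - F0 \<longrightarrow> norm (\<Sum>n\<in>F. c n *\<^sub>C \<phi> n) < e)"
    by blast
qed

text \<open>Analysis by the first sequence followed by synthesis with the second. It covers both the
  frame operator (equal sequences) and the multiplier (with \<open>m\<close> absorbed into the
  synthesis sequence).\<close>

definition mixed_operator ::
    "'i set \<Rightarrow> ('i \<Rightarrow> 'h::complex_inner) \<Rightarrow> ('i \<Rightarrow> 'h) \<Rightarrow> 'h \<Rightarrow> 'h" where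
  "mixed_operator I \<eta> \<psi> f = (\<Sum>\<^sub>\<infinity>n\<in>I. cinner f (\<eta> n) *\<^sub>C \<psi> n)"

lemma frame_operator_eq_mixed: "frame_operator I \<phi> = mixed_operator I \<phi> \<phi>"
  by (simp add: fun_eq_iff frame_operator_def mixed_operator_def)

lemma mixed_operator_has_sum:
  fixes \<eta> \<psi> :: "'i \<Rightarrow> 'h::chilbert_space"
  assumes "bessel I \<eta> B" "bessel I \<psi> C"
  shows "((\<lambda>n. cinner f (\<eta> n) *\<^sub>C \<psi> n) has_sum mixed_operator I \<eta> \<psi> f) I"
  unfolding mixed_operator_def
  by (intro has_sum_infsum bessel_synthesis_summable[OF assms(2)] bessel_summable[OF assms(1)])

text \<open>Every finite partial sum satisfies the bound, by the synthesis estimate for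
  \<open>\<psi>\<close> and the Bessel inequality for \<open>\<eta>\<close>; the bound survives the
  limit.\<close>

lemma norm_mixed_operator_le:
  fixes \<eta> \<psi> :: "'i \<Rightarrow> 'h::chilbert_space"
  assumes "bessel I \<eta> B" "bessel I \<psi> C"
  shows "norm (mixed_operator I \<eta> \<psi> f) \<le> norm f * sqrt (C * B)"
proof (rule tendsto_upperbound[OF _ _ finite_subsets_at_top_neq_bot])
  show "((\<lambda>F. norm (\<Sum>n\<in>F. cinner f (\<eta> n) *\<^sub>C \<psi> n)) \<longlongrightarrow> norm (mixed_operator I \<eta> \<psi> f))
          (finite_subsets_at_top I)"
    using mixed_operator_has_sum[OF assms] unfolding has_sum_def by (rule tendsto_norm)
  have "norm (\<Sum>n\<in>F. cinner f (\<eta> n) *\<^sub>C \<psi> n) \<le> norm f * sqrt (C * B)"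
    if F: "finite F" "F \<subseteq> I" for F
  proof (rule power2_le_imp_le)
    have "(norm (\<Sum>n\<in>F. cinner f (\<eta> n) *\<^sub>C \<psi> n))\<^sup>2 \<le> C * (\<Sum>n\<in>F. (cmod (cinner f (\<eta> n)))\<^sup>2)"
      by (rule bessel_synthesis_le[OF assms(2) F])
    also have "\<dots> \<le> C * (B * (norm f)\<^sup>2)"
      using assms F by (intro mult_left_mono) (auto simp: bessel_def)
    also have "\<dots> = (norm f * sqrt (C * B))\<^sup>2"
      using assms by (simp add: power_mult_distrib bessel_def)
    finally show "(norm (\<Sum>n\<in>F. cinner f (\<eta> n) *\<^sub>C \<psi> n))\<^sup>2 \<le> (norm f * sqrt (C * B))\<^sup>2" .
  qed (use assms in \<open>simp add: bessel_def\<close>)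
  then show "eventually (\<lambda>F. norm (\<Sum>n\<in>F. cinner f (\<eta> n) *\<^sub>C \<psi> n) \<le> norm f * sqrt (C * B))
      (finite_subsets_at_top I)"
    by (rule eventually_finite_subsets_at_top_weakI)
qed

lemma bounded_clinear_mixed_operator:
  fixes \<eta> \<psi> :: "'i \<Rightarrow> 'h::chilbert_space"
  assumes "bessel I \<eta> B" "bessel I \<psi> C"
  shows "bounded_clinear (mixed_operator I \<eta> \<psi>)"
proof -
  note sums = mixed_operator_has_sum[OF assms]
  have scaleC: "mixed_operator I \<eta> \<psi> (a *\<^sub>C f) = a *\<^sub>C mixed_operator I \<eta> \<psi> f" for a f
    using has_sum_unique[OF sums[of "a *\<^sub>C f"]]
      has_sum_bounded_linear[OF bounded_linear_scaleC[of a] sums[of f]]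
    by (simp add: cinner_scaleC_left scaleC_scaleC o_def)
  moreover have "bounded_linear (mixed_operator I \<eta> \<psi>)"
  proof (rule bounded_linear_intro)
    show "mixed_operator I \<eta> \<psi> (f + g) = mixed_operator I \<eta> \<psi> f + mixed_operator I \<eta> \<psi> g" for f g
      using has_sum_unique[OF sums[of "f + g"]] has_sum_add[OF sums[of f] sums[of g]]
      by (simp add: cinner_add_left scaleC_add_left)
    show "mixed_operator I \<eta> \<psi> (r *\<^sub>R f) = r *\<^sub>R mixed_operator I \<eta> \<psi> f" for r f
      by (simp add: scaleR_scaleC scaleC)
    show "norm (mixed_operator I \<eta> \<psi> f) \<le> norm f * sqrt (C * B)" for f
      by (rule norm_mixed_operator_le[OF assms])
  qed
  ultimately show ?thesis
    by (simp add: bounded_clinear_def)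
qed

text \<open>Pairing with \<open>g\<close> is continuous, so it passes through the series. This
  expansion yields both the self-adjointness and the coercivity of the frame operator.\<close>

lemma cinner_frame_operator_has_sum:
  fixes \<phi> :: "'i \<Rightarrow> 'h::chilbert_space"
  assumes "bessel I \<phi> B"
  shows "((\<lambda>n. cinner f (\<phi> n) * cnj (cinner g (\<phi> n))) has_sum cinner (frame_operator I \<phi> f) g) I"
proof -
  have "cinner (cinner f (\<phi> n) *\<^sub>C \<phi> n) g = cinner f (\<phi> n) * cnj (cinner g (\<phi> n))" for n
    by (metis cinner_commute cinner_scaleC_left)
  then show ?thesis
    using has_sum_bounded_linear[OF bounded_linear_cinner_left[of g]
        mixed_operator_has_sum[OF assms assms, of f]]
    by (simp add: frame_operator_eq_mixed o_def)
qed

text \<open>Conjugating the expansion with \<open>f\<close> and \<open>g\<close> swapped gives back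
  the same series, and sums are unique.\<close>

lemma cinner_frame_operator_commute:
  fixes \<phi> :: "'i \<Rightarrow> 'h::chilbert_space"
  assumes "bessel I \<phi> B"
  shows "cinner (frame_operator I \<phi> f) g = cinner f (frame_operator I \<phi> g)"
proof -
  have "((\<lambda>n. cinner f (\<phi> n) * cnj (cinner g (\<phi> n))) has_sum
      cnj (cinner (frame_operator I \<phi> g) f)) I"
    using has_sum_bounded_linear[OF bounded_linear_cnj cinner_frame_operator_has_sum[OF assms, of g f]]
    by (simp add: o_def mult.commute)
  then show ?thesis
    using cinner_frame_operator_has_sum[OF assms, of f g]
    by (metis cinner_commute has_sum_unique)
qed

subsection \<open>Inverting the frame operator\<close>

text \<open>For \<open>g = f\<close> the expansion of the quadratic form is the sum in the frame
  inequality, so the lower frame bound is coercivity.\<close>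

lemma frame_operator_lower_bound:
  fixes \<phi> :: "'i \<Rightarrow> 'h::chilbert_space"
  assumes "frame I \<phi>"
  shows "\<exists>A>0. \<forall>f. A * (norm f)\<^sup>2 \<le> Re (cinner (frame_operator I \<phi> f) f)"
proof -
  obtain A where A: "A > 0" "\<And>f. A * (norm f)\<^sup>2 \<le> (\<Sum>\<^sub>\<infinity>n\<in>I. (cmod (cinner f (\<phi> n)))\<^sup>2)"
    using assms unfolding frame_def by blast
  obtain B where B: "bessel I \<phi> B"
    using assms by (rule frame_bessel)
  have "Re (z * cnj z) = (cmod z)\<^sup>2" for z
    by (simp add: cmod_power2 flip: power2_eq_square)
  then have "((\<lambda>n. (cmod (cinner f (\<phi> n)))\<^sup>2) has_sum Re (cinner (frame_operator I \<phi> f) f)) I" for f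
    using has_sum_bounded_linear[OF bounded_linear_Re cinner_frame_operator_has_sum[OF B, of f f]]
    by (simp only: o_def)
  then have "(\<Sum>\<^sub>\<infinity>n\<in>I. (cmod (cinner f (\<phi> n)))\<^sup>2) = Re (cinner (frame_operator I \<phi> f) f)" for f
    by (rule infsumI)
  with A show ?thesis
    by auto
qed

text \<open>For small \<open>\<lambda> > 0\<close> the map \<open>x \<mapsto> x - \<lambda> (S x - y)\<close> is a contraction whose fixed points are
  the solutions of \<open>S x = y\<close>.\<close>

lemma bij_coercive:
  fixes S :: "'h::chilbert_space \<Rightarrow> 'h"
  assumes S: "bounded_clinear S"
    and A: "A > 0" "\<And>x. A * (norm x)\<^sup>2 \<le> Re (cinner (S x) x)"
  shows "bij S"
proof -
  interpret S: bounded_linear S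
    using S by (simp add: bounded_clinear_def)
  obtain B where B: "B > 0" "\<And>x. norm (S x) \<le> norm x * B"
    using S.pos_bounded by blast
  \<comment> \<open>Expanding the square gives the factor
    \<open>1 - 2 * (l * A) + l\<^sup>2 * B\<^sup>2\<close>. With \<open>l = A / K\<close> and
    \<open>B\<^sup>2 \<le> K\<close> it is at most \<open>q\<close>. Including
    \<open>A\<^sup>2\<close> in \<open>K\<close> ensures \<open>0 \<le> q\<close> without comparing
    \<open>A\<close> and \<open>B\<close>.\<close>
  define K where "K = A\<^sup>2 + B\<^sup>2"
  define l where "l = A / K"
  define q where "q = 1 - A\<^sup>2 / K"
  have K: "K > 0" "A\<^sup>2 \<le> K" "B\<^sup>2 \<le> K"
    using A(1) by (simp_all add: K_def add_pos_nonneg)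
  have "l > 0" "0 \<le> q" "q < 1"
    using A(1) K by (simp_all add: l_def q_def)
  have "l * A = A\<^sup>2 / K"
    by (simp add: l_def power2_eq_square)
  moreover have "l\<^sup>2 * K = A\<^sup>2 / K"
    using K(1) by (simp add: l_def power2_eq_square)
  moreover have "l\<^sup>2 * B\<^sup>2 \<le> l\<^sup>2 * K"
    using K(3) by (rule mult_left_mono) simp
  ultimately have q: "1 - 2 * (l * A) + l\<^sup>2 * B\<^sup>2 \<le> q"
    unfolding q_def by linarith
  have contr: "norm (x - l *\<^sub>R S x) \<le> sqrt q * norm x" for x
  proof (rule power2_le_imp_le)
    have "(norm (x - l *\<^sub>R S x))\<^sup>2 = (norm x)\<^sup>2 - 2 * l * Re (cinner (S x) x) + l\<^sup>2 * (norm (S x))\<^sup>2"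
    proof -
      have "cinner (l *\<^sub>R S x) x = of_real l * cinner (S x) x"
        by (simp only: scaleR_scaleC cinner_scaleC_left)
      then show ?thesis
        by (simp add: norm_diff_square power_mult_distrib)
    qed
    also have "\<dots> \<le> (norm x)\<^sup>2 - 2 * l * (A * (norm x)\<^sup>2) + l\<^sup>2 * (norm x * B)\<^sup>2"
      using A(2) B \<open>l > 0\<close>
      by (intro add_mono diff_mono mult_left_mono power_mono) auto
    also have "\<dots> = (1 - 2 * (l * A) + l\<^sup>2 * B\<^sup>2) * (norm x)\<^sup>2"
      by (simp add: algebra_simps power_mult_distrib)
    also have "\<dots> \<le> q * (norm x)\<^sup>2"
      using q by (rule mult_right_mono) simp
    also have "\<dots> = (sqrt q * norm x)\<^sup>2"
      using \<open>0 \<le> q\<close> by (simp add: power_mult_distrib)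
    finally show "(norm (x - l *\<^sub>R S x))\<^sup>2 \<le> (sqrt q * norm x)\<^sup>2" .
  qed (use \<open>0 \<le> q\<close> in simp)
  have "\<exists>!x. S x = y" for y
  proof -
    have "\<exists>!x. x - l *\<^sub>R (S x - y) = x"
    proof (rule banach_fix_type)
      show "\<forall>u v. dist (u - l *\<^sub>R (S u - y)) (v - l *\<^sub>R (S v - y)) \<le> sqrt q * dist u v"
      proof (intro allI)
        fix u v
        \<comment> \<open>The constant \<open>y\<close> cancels in the difference, so the linear
          estimate \<open>contr\<close> is a Lipschitz bound for the affine map.\<close>
        have "(u - l *\<^sub>R (S u - y)) - (v - l *\<^sub>R (S v - y)) = (u - v) - l *\<^sub>R S (u - v)"
          by (simp add: S.diff algebra_simps)
        then show "dist (u - l *\<^sub>R (S u - y)) (v - l *\<^sub>R (S v - y)) \<le> sqrt q * dist u v"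
          using contr[of "u - v"] unfolding dist_norm by (simp only:)
      qed
    qed (use \<open>0 \<le> q\<close> \<open>q < 1\<close> in auto)
    then show ?thesis
      using \<open>l > 0\<close> by simp
  qed
  then show ?thesis
    by (simp add: bij_iff)
qed

lemma bounded_clinear_frame_operator:
  fixes \<phi> :: "'i \<Rightarrow> 'h::chilbert_space"
  assumes "frame I \<phi>"
  shows "bounded_clinear (frame_operator I \<phi>)"
proof -
  obtain B where "bessel I \<phi> B"
    using assms by (rule frame_bessel)
  from bounded_clinear_mixed_operator[OF this this] show ?thesis
    by (simp add: frame_operator_eq_mixed)
qed

lemma bij_frame_operator:
  fixes \<phi> :: "'i \<Rightarrow> 'h::chilbert_space"
  assumes "frame I \<phi>"
  shows "bij (frame_operator I \<phi>)"
proof -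
  obtain A where "A > 0" "\<And>f. A * (norm f)\<^sup>2 \<le> Re (cinner (frame_operator I \<phi> f) f)"
    using frame_operator_lower_bound[OF assms] by auto
  then show ?thesis
    by (rule bij_coercive[OF bounded_clinear_frame_operator[OF assms]])
qed

text \<open>Coercivity and Cauchy-Schwarz bound \<open>A * (norm f)\<^sup>2\<close> by
  \<open>norm (frame_operator I \<phi> f) * norm f\<close>; cancelling \<open>norm f\<close> leaves
  the lower bound that makes the inverse bounded.\<close>

lemma bounded_clinear_inv_frame_operator:
  fixes \<phi> :: "'i \<Rightarrow> 'h::chilbert_space"
  assumes "frame I \<phi>"
  shows "bounded_clinear (inv (frame_operator I \<phi>))"
proof -
  obtain A where A: "A > 0" "\<And>f. A * (norm f)\<^sup>2 \<le> Re (cinner (frame_operator I \<phi> f) f)"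
    using frame_operator_lower_bound[OF assms] by auto
  have "A * norm f \<le> norm (frame_operator I \<phi> f)" for f
  proof (cases "f = 0")
    case False
    have "A * norm f * norm f \<le> norm (frame_operator I \<phi> f) * norm f"
      using order_trans[OF A(2)[of f] order_trans[OF complex_Re_le_cmod norm_cinner_le]]
      by (simp add: power2_eq_square mult.assoc)
    with False show ?thesis
      by simp
  qed simp
  then show ?thesis
    using bounded_clinear_frame_operator[OF assms] bij_frame_operator[OF assms] A(1)
    by (intro bounded_clinear_inv)
qed

section \<open>Canonical duals and the reconstruction formula\<close>

lemma frame_operator_inv:
  fixes \<phi> :: "'i \<Rightarrow> 'h::chilbert_space"
  assumes "frame I \<phi>"
  shows "frame_operator I \<phi> (inv (frame_operator I \<phi>) f) = f"
  using bij_frame_operator[OF assms] by (simp add: bij_is_surj surj_f_inv_f)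

lemma cinner_canonical_dual:
  fixes \<phi> :: "'i \<Rightarrow> 'h::chilbert_space"
  assumes "frame I \<phi>"
  shows "cinner f (canonical_dual I \<phi> n) = cinner (inv (frame_operator I \<phi>) f) (\<phi> n)"
proof -
  obtain B where "bessel I \<phi> B"
    using assms by (rule frame_bessel)
  \<comment> \<open>Self-adjointness moves the frame operator across: on the left it cancels the
    inverse applied to \<open>f\<close>, on the right it turns the dual vector into
    \<open>\<phi> n\<close>.\<close>
  from cinner_frame_operator_commute[OF this, of "inv (frame_operator I \<phi>) f" "canonical_dual I \<phi> n"]
  show ?thesis
    by (simp add: canonical_dual_def frame_operator_inv[OF assms])
qed

lemma frame_reconstruction:
  fixes \<phi> :: "'i \<Rightarrow> 'h::chilbert_space"
  assumes "frame I \<phi>"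
  shows "((\<lambda>n. cinner f (canonical_dual I \<phi> n) *\<^sub>C \<phi> n) has_sum f) I"
proof -
  obtain B where "bessel I \<phi> B"
    using assms by (rule frame_bessel)
  \<comment> \<open>The reconstruction series is the frame operator series at the preimage of
    \<open>f\<close>.\<close>
  from mixed_operator_has_sum[OF this this, of "inv (frame_operator I \<phi>) f"]
  show ?thesis
    by (simp add: cinner_canonical_dual[OF assms] frame_operator_inv[OF assms]
        flip: frame_operator_eq_mixed)
qed

section \<open>Equivalent frames\<close>

lemma mixed_operator_equivalent:
  fixes \<psi> :: "'i \<Rightarrow> 'h::chilbert_space"
  assumes "frame I \<psi>" "bounded_clinear G" "\<And>n. n \<in> I \<Longrightarrow> \<eta> n = G (\<psi> n)"
  shows "mixed_operator I \<psi> \<eta> = G \<circ> frame_operator I \<psi>"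
proof
  fix f
  obtain B where B: "bessel I \<psi> B"
    using assms(1) by (rule frame_bessel)
  have "bounded_linear G"
    using assms(2) by (simp add: bounded_clinear_def)
  from has_sum_bounded_linear[OF this mixed_operator_has_sum[OF B B, of f]]
  have "((\<lambda>n. cinner f (\<psi> n) *\<^sub>C G (\<psi> n)) has_sum G (frame_operator I \<psi> f)) I"
    using assms(2) by (simp add: o_def bounded_clinear_def frame_operator_eq_mixed)
  then show "mixed_operator I \<psi> \<eta> f = (G \<circ> frame_operator I \<psi>) f"
    using assms(3) by (simp add: mixed_operator_def infsumI cong: infsum_cong)
qed

text \<open>If \<open>\<eta> = G \<psi>\<close>, then \<open>G (\<Sum> \<langle>S\<^sup>-\<^sup>1 f, \<eta>\<^sub>n\<rangle> \<psi>\<^sub>n) = f\<close> with \<open>S\<close> the frame operator of \<open>\<eta>\<close>.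
  This gives boundedness of the inverse of \<open>G\<close> without the open mapping theorem.\<close>

lemma bounded_clinear_inv_equivalence:
  fixes \<psi> \<eta> :: "'i \<Rightarrow> 'h::chilbert_space"
  assumes "frame I \<psi>" "frame I \<eta>" "bounded_clinear G" "bij G"
    and "\<And>n. n \<in> I \<Longrightarrow> \<eta> n = G (\<psi> n)"
  shows "bounded_clinear (inv G)"
proof -
  obtain B where B: "bessel I \<psi> B"
    using assms(1) by (rule frame_bessel)
  obtain C where C: "bessel I \<eta> C"
    using assms(2) by (rule frame_bessel)
  have "G (mixed_operator I \<eta> \<psi> f) = frame_operator I \<eta> f" for f
  proof -
    have "bounded_linear G"
      using assms(3) by (simp add: bounded_clinear_def)
    from has_sum_bounded_linear[OF this mixed_operator_has_sum[OF C B, of f]]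
    have "((\<lambda>n. cinner f (\<eta> n) *\<^sub>C G (\<psi> n)) has_sum G (mixed_operator I \<eta> \<psi> f)) I"
      using assms(3) by (simp add: o_def bounded_clinear_def)
    then have "(\<Sum>\<^sub>\<infinity>n\<in>I. cinner f (\<eta> n) *\<^sub>C G (\<psi> n)) = G (mixed_operator I \<eta> \<psi> f)"
      by (rule infsumI)
    moreover have "frame_operator I \<eta> f = (\<Sum>\<^sub>\<infinity>n\<in>I. cinner f (\<eta> n) *\<^sub>C G (\<psi> n))"
      unfolding frame_operator_def by (rule infsum_cong) (simp only: assms(5))
    ultimately show ?thesis
      by (simp only:)
  qed
  then have "G (mixed_operator I \<eta> \<psi> (inv (frame_operator I \<eta>) f)) = f" for f
    by (simp add: frame_operator_inv[OF assms(2)])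
  \<comment> \<open>A right inverse of the injective \<open>G\<close> is its inverse; here it is a
    composition of bounded operators.\<close>
  then have "inv G = mixed_operator I \<eta> \<psi> \<circ> inv (frame_operator I \<eta>)"
    using assms(4) by (metis bij_is_inj comp_apply ext inv_f_f)
  then show ?thesis
    using bounded_clinear_comp[OF bounded_clinear_mixed_operator[OF C B]
        bounded_clinear_inv_frame_operator[OF assms(2)]]
    by simp
qed

subsection \<open>Multipliers\<close>

text \<open>The Bessel bounds of \<open>\<psi>\<close> and of the weighted sequence make the series
  converge for every \<open>f\<close>, so the partial map is total.\<close>

lemma multiplier_eq_mixed_operator:
  fixes \<phi> \<psi> :: "'i \<Rightarrow> 'h::chilbert_space"
  assumes "frame I \<psi>" "frame I (\<lambda>n. m n *\<^sub>C \<phi> n)"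
  shows "multiplier I m \<phi> \<psi> = (\<lambda>f. Some (mixed_operator I \<psi> (\<lambda>n. m n *\<^sub>C \<phi> n) f))"
proof
  fix f
  obtain B where B: "bessel I \<psi> B"
    using assms(1) by (rule frame_bessel)
  obtain C where C: "bessel I (\<lambda>n. m n *\<^sub>C \<phi> n) C"
    using assms(2) by (rule frame_bessel)
  from mixed_operator_has_sum[OF B C, of f]
  have "((\<lambda>n. (m n * cinner f (\<psi> n)) *\<^sub>C \<phi> n) has_sum
      mixed_operator I \<psi> (\<lambda>n. m n *\<^sub>C \<phi> n) f) I"
    by (simp add: scaleC_scaleC mult.commute)
  then show "multiplier I m \<phi> \<psi> f = Some (mixed_operator I \<psi> (\<lambda>n. m n *\<^sub>C \<phi> n) f)"
    by (simp add: multiplier_def has_sum_imp_summable infsumI)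
qed

section \<open>Inverses of total operators viewed as partial maps\<close>

lemma inverse_operator_total:
  assumes "bij G"
  shows "inverse_operator (\<lambda>f. Some (G f)) = (\<lambda>g. Some (inv G g))"
proof
  fix g
  have "g \<in> ran (\<lambda>f. Some (G f))"
    using surj_f_inv_f[OF bij_is_surj[OF assms], of g] by (auto simp: ran_def)
  moreover have "(THE f. G f = g) = inv G g"
    using assms by (intro the_equality) (auto simp: bij_is_surj bij_is_inj surj_f_inv_f)
  ultimately show "inverse_operator (\<lambda>f. Some (G f)) g = Some (inv G g)"
    by (simp add: inverse_operator_def)
qed

lemma invertible_operator_total: "invertible_operator (\<lambda>f. Some (G f)) \<longleftrightarrow> bounded_clinear G \<and> bij G"
proof -
  have "(\<lambda>f. Some (G f)) = (\<lambda>f. Some (F f)) \<longleftrightarrow> G = F" for F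
    by (auto simp: fun_eq_iff)
  then show ?thesis
    by (simp add: invertible_operator_def)
qed

text \<open>\<open>H\<close> stands for the inverse of the equivalence. Composed with the inverse
  frame operator of \<open>\<psi>\<close>, it sends \<open>m n *\<^sub>C \<phi> n\<close> to the
  canonical dual vector, so the reconstruction formula for \<open>\<phi>\<close> is carried termwise
  to the multiplier series.\<close>

lemma multiplier_inverse_canonical_duals:
  fixes \<phi> \<psi> :: "'i \<Rightarrow> 'h::chilbert_space"
  assumes "frame I \<phi>" "frame I \<psi>"
    and m: "\<And>n. n \<in> I \<Longrightarrow> m n \<noteq> 0"
    and H: "bounded_clinear H" "\<And>n. n \<in> I \<Longrightarrow> H (m n *\<^sub>C \<phi> n) = \<psi> n"
  shows "multiplier I (\<lambda>n. 1 / m n) (canonical_dual I \<psi>) (canonical_dual I \<phi>) =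
    (\<lambda>f. Some (inv (frame_operator I \<psi>) (H f)))"
proof
  fix f
  let ?L = "inv (frame_operator I \<psi>) \<circ> H"
  have L: "bounded_clinear ?L"
    by (intro bounded_clinear_comp bounded_clinear_inv_frame_operator assms)
  have term_eq: "?L (cinner f (canonical_dual I \<phi> n) *\<^sub>C \<phi> n) =
      (1 / m n * cinner f (canonical_dual I \<phi> n)) *\<^sub>C canonical_dual I \<psi> n" if "n \<in> I" for n
  proof -
    let ?c = "cinner f (canonical_dual I \<phi> n)"
    \<comment> \<open>\<open>\<phi> n\<close> is rescaled to \<open>m n *\<^sub>C \<phi> n\<close>,
      where \<open>H\<close> is known; this is where the weight \<open>1 / m n\<close>
      arises.\<close>
    have "?L (?c *\<^sub>C \<phi> n) = ?L ((1 / m n * ?c) *\<^sub>C (m n *\<^sub>C \<phi> n))"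
      using m[OF that] by (simp add: scaleC_scaleC)
    also have "\<dots> = (1 / m n * ?c) *\<^sub>C ?L (m n *\<^sub>C \<phi> n)"
      using L unfolding bounded_clinear_def by blast
    also have "?L (m n *\<^sub>C \<phi> n) = canonical_dual I \<psi> n"
      by (simp only: comp_apply H(2)[OF that] canonical_dual_def)
    finally show ?thesis .
  qed
  have "bounded_linear ?L"
    using L by (simp add: bounded_clinear_def)
  from has_sum_bounded_linear[OF this frame_reconstruction[OF assms(1), of f]]
  have "((\<lambda>n. (1 / m n * cinner f (canonical_dual I \<phi> n)) *\<^sub>C canonical_dual I \<psi> n)
      has_sum ?L f) I"
    using has_sum_cong[of I, OF term_eq] by (simp add: o_def)
  then show "multiplier I (\<lambda>n. 1 / m n) (canonical_dual I \<psi>) (canonical_dual I \<phi>) f =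
      Some (inv (frame_operator I \<psi>) (H f))"
    by (simp add: multiplier_def has_sum_imp_summable infsumI)
qed

theorem proposition3p18:
  fixes I :: "'i set"
    and \<phi> \<psi> :: "'i \<Rightarrow> 'h::chilbert_space"
    and m :: "'i \<Rightarrow> complex"
  assumes "countable I"
    and "separable_space (euclidean :: 'h topology)"
    and "frame I \<phi>"
    and "frame I \<psi>"
    and "\<forall>n\<in>I. m n \<noteq> 0"
    and "frame I (\<lambda>n. m n *\<^sub>C \<phi> n)"
  shows
    "((invertible_operator (multiplier I m \<phi> \<psi>) \<and>
        (\<forall>n\<in>I. multiplier_dual I m \<phi> \<psi> n = canonical_dual I \<psi> n))
      \<longleftrightarrow> equivalent_frames I \<psi> (\<lambda>n. m n *\<^sub>C \<phi> n))
     \<and>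
     (equivalent_frames I \<psi> (\<lambda>n. m n *\<^sub>C \<phi> n)
      \<longrightarrow> invertible_operator (multiplier I m \<phi> \<psi>) \<and>
          inverse_operator (multiplier I m \<phi> \<psi>) =
            multiplier I (\<lambda>n. 1 / m n) (canonical_dual I \<psi>) (canonical_dual I \<phi>))"
proof (intro conjI iffI impI)
  let ?\<eta> = "\<lambda>n. m n *\<^sub>C \<phi> n"
  let ?S = "frame_operator I \<psi>"
  let ?M = "mixed_operator I \<psi> ?\<eta>"
  note \<psi> = assms(4) and \<eta> = assms(6)
  note mult = multiplier_eq_mixed_operator[OF \<psi> \<eta>]
  show "equivalent_frames I \<psi> ?\<eta>"
    if 1: "invertible_operator (multiplier I m \<phi> \<psi>) \<and>
        (\<forall>n\<in>I. multiplier_dual I m \<phi> \<psi> n = canonical_dual I \<psi> n)"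
  proof -
    have M: "bounded_clinear ?M" "bij ?M"
      using 1 by (simp_all add: mult invertible_operator_total)
    \<comment> \<open>The condition on the dual sequence, unfolded; applying \<open>?M\<close>
      reveals \<open>?M \<circ> inv ?S\<close> as the equivalence.\<close>
    have "inv ?M (?\<eta> n) = inv ?S (\<psi> n)" if "n \<in> I" for n
      using 1 that M
      by (simp add: mult multiplier_dual_def canonical_dual_def inverse_operator_total)
    then have "?\<eta> n = (?M \<circ> inv ?S) (\<psi> n)" if "n \<in> I" for n
      using surj_f_inv_f[OF bij_is_surj[OF M(2)], of "?\<eta> n"] that by simp
    moreover have "bounded_clinear (?M \<circ> inv ?S)"
      using M(1) bounded_clinear_inv_frame_operator[OF \<psi>] by (rule bounded_clinear_comp)
    moreover have "bij (?M \<circ> inv ?S)"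
      using M(2) bij_frame_operator[OF \<psi>] by (blast intro: bij_comp bij_imp_bij_inv)
    ultimately show ?thesis
      unfolding equivalent_frames_def by blast
  qed
  assume "equivalent_frames I \<psi> ?\<eta>"
  then obtain G where G: "bounded_clinear G" "bij G" "\<And>n. n \<in> I \<Longrightarrow> ?\<eta> n = G (\<psi> n)"
    unfolding equivalent_frames_def by blast
  have M: "?M = G \<circ> ?S"
    using \<psi> G(1,3) by (rule mixed_operator_equivalent)
  have "bij ?M"
    unfolding M using bij_frame_operator[OF \<psi>] G(2) by (rule bij_comp)
  moreover have "bounded_clinear ?M"
    unfolding M using G(1) bounded_clinear_frame_operator[OF \<psi>] by (rule bounded_clinear_comp)
  ultimately show "invertible_operator (multiplier I m \<phi> \<psi>)"
    by (simp add: mult invertible_operator_total)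
  \<comment> \<open>Invertibility is a separate goal in each of (1) and (3), hence shown
    twice.\<close>
  then show "invertible_operator (multiplier I m \<phi> \<psi>)" .
  have inv_M: "inv ?M = inv ?S \<circ> inv G"
    unfolding M using G(2) bij_frame_operator[OF \<psi>] by (rule o_inv_distrib)
  have inverse: "inverse_operator (multiplier I m \<phi> \<psi>) = (\<lambda>g. Some (inv ?S (inv G g)))"
    using inverse_operator_total[OF \<open>bij ?M\<close>] by (simp add: mult inv_M)
  have inv_G: "inv G (?\<eta> n) = \<psi> n" if "n \<in> I" for n
    using G(2) G(3)[OF that] by (simp add: bij_is_inj)
  then show "\<forall>n\<in>I. multiplier_dual I m \<phi> \<psi> n = canonical_dual I \<psi> n"
    by (simp add: multiplier_dual_def inverse canonical_dual_def)
  \<comment> \<open>Boundedness lets \<open>inv G\<close> play the role of \<open>H\<close> and pass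
    through the reconstruction series.\<close>
  have "bounded_clinear (inv G)"
    using \<psi> \<eta> G by (rule bounded_clinear_inv_equivalence)
  then show "inverse_operator (multiplier I m \<phi> \<psi>) =
      multiplier I (\<lambda>n. 1 / m n) (canonical_dual I \<psi>) (canonical_dual I \<phi>)"
    using multiplier_inverse_canonical_duals[OF assms(3) \<psi> _ _ inv_G] assms(5) inverse by simp
qed

end
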